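(* Let $G\curvearrowright X$ be a continuous isometric action by an amenable topological group $G$ on a metric space $X$ and assume that the linear operator $R:(\mathfrak{Lip}(X))^G\to\mathrm{Hom}(G,\mathbb{R})$, defined by letting $(R\phi)(g)$ be the constant value of $\phi-\phi(g\,\cdot\,)$, has rank $0$. Then $$\{\phi\in\mathfrak{Lip}(X)\mid\phi\text{ is constant on every orbit of }G\curvearrowright X\}$$ is $1$-complemented in $\mathfrak{Lip}(X)$.
   Context: A topological group $G$ is amenable if every continuous affine action of $G$ on a non-empty compact convex subset of a locally convex topological vector space has a fixed point. Equivalently, there is a mean $\mathfrak m$ (positive linear functional of norm $1$ with $\mathfrak m(\mathbf 1)=1$) on the algebra $\mathsf{LUCB}(G)$ of bounded functions $\phi:G\to\mathbb R$ for which $g\mapsto\phi(\,\cdot\,g)$ is continuous in the sup norm, such that $\mathfrak m(\phi(\,\cdot\, g))=\mathfrak m(\phi)$ for all $g\in G$. For a metric space $X$, $\mathfrak{Lip}(X)=\mathsf{Lip}(X)/\{\text{constant functions}\}$, where $\mathsf{Lip}(X)$ is the space of real-valued Lipschitz functions on $X$; it is a Banach space under the norm $L(\phi)=\sup_{x\ne y}|\phi(x)-\phi(y)|/d(x,y)$. Elements are identified with representatives in $\mathsf{Lip}(X)$. The group $G$ acts on $\mathfrak{Lip}(X)$ by $g\cdot\phi=\phi(g^{-1}\,\cdot\,)$, and $$(\mathfrak{Lip}(X))^G=\{\phi\in\mathfrak{Lip}(X)\mid\text{for all }g\in G,\ \phi-\phi(g\,\cdot\,)\text{ is a constant function on }X\}.$$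 $\mathrm{Hom}(G,\mathbb{R})$ is the vector space of continuous homomorphisms $G\to\mathbb{R}$; for $\phi\in(\mathfrak{Lip}(X))^G$ the map $R\phi$ is such a homomorphism. A closed subspace is $1$-complemented if it is the range of a linear projection of norm at most $1$. *)

theory Defs
  imports "HOL-Analysis.Analysis" "HOL-Library.Function_Algebras"
begin

section \<open>Topological groups acting on metric spaces\<close>

text \<open>
  The library class of (not necessarily abelian) topological groups is
  \<^class>\<open>topological_group_add\<close>. It is written additively, so \<open>g + h\<close>, \<open>0\<close> and \<open>- g\<close> stand for
  the product, the neutral element and the inverse, and no commutativity is assumed.
\<close>

definition continuous_isometric_action ::
    "('g::topological_group_add \<Rightarrow> 'x::metric_space \<Rightarrow> 'x) \<Rightarrow> bool" where
  "continuous_isometric_action act \<longleftrightarrow>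
     (\<forall>x. act 0 x = x) \<and>
     (\<forall>g h x. act (g + h) x = act g (act h x)) \<and>
     (\<forall>g x y. dist (act g x) (act g y) = dist x y) \<and>
     continuous_on UNIV (\<lambda>(g, x). act g x)"

definition orbit :: "('g \<Rightarrow> 'x \<Rightarrow> 'x) \<Rightarrow> 'x \<Rightarrow> 'x set" where
  "orbit act x = range (\<lambda>g. act g x)"

section \<open>Amenability\<close>

text \<open>
  Uniform convergence on \<^const>\<open>UNIV\<close> is convergence in the sup norm; the filter \<open>nhds g\<close> makes the
  condition continuity of \<open>h \<mapsto> \<phi>(\<cdot> h)\<close> at \<open>g\<close>.
\<close>

definition LUCB :: "('g::topological_group_add \<Rightarrow> real) set" where
  "LUCB = {\<phi>. bounded (range \<phi>) \<and>
     (\<forall>g. uniform_limit UNIV (\<lambda>h x. \<phi> (x + h)) (\<lambda>x. \<phi> (x + g)) (nhds g))}"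

definition is_mean :: "(('g::topological_group_add \<Rightarrow> real) \<Rightarrow> real) \<Rightarrow> bool" where
  "is_mean m \<longleftrightarrow>
     (\<forall>\<phi>\<in>LUCB. \<forall>\<psi>\<in>LUCB. m (\<lambda>x. \<phi> x + \<psi> x) = m \<phi> + m \<psi>) \<and>
     (\<forall>\<phi>\<in>LUCB. \<forall>c. m (\<lambda>x. c * \<phi> x) = c * m \<phi>) \<and>
     (\<forall>\<phi>\<in>LUCB. (\<forall>x. 0 \<le> \<phi> x) \<longrightarrow> 0 \<le> m \<phi>) \<and>
     (SUP \<phi>\<in>{\<phi> \<in> LUCB. \<forall>x. \<bar>\<phi> x\<bar> \<le> 1}. \<bar>m \<phi>\<bar>) = 1 \<and>
     m (\<lambda>x. 1) = 1"

text \<open>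
  The characterisation of amenability by an invariant mean is used, since HOL cannot quantify over
  all locally convex spaces inside a definition. As \<open>'g\<close> is a type, the predicate takes a
  type token.
\<close>

definition amenable :: "'g::topological_group_add itself \<Rightarrow> bool" where
  "amenable _ \<longleftrightarrow>
     (\<exists>m :: ('g \<Rightarrow> real) \<Rightarrow> real. is_mean m \<and>
        (\<forall>\<phi>\<in>LUCB. \<forall>g. m (\<lambda>x. \<phi> (x + g)) = m \<phi>))"

section \<open>Lipschitz functions modulo constants\<close>

definition Lip :: "('x::metric_space \<Rightarrow> real) set" where
  "Lip = {f. \<exists>C. C-lipschitz_on UNIV f}"

lemma Lip_iff: "f \<in> Lip \<longleftrightarrow> (\<exists>C. \<forall>x y. \<bar>f x - f y\<bar> \<le> C * dist x y)"
proof
  assume "f \<in> Lip"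
  then show "\<exists>C. \<forall>x y. \<bar>f x - f y\<bar> \<le> C * dist x y"
    by (auto simp: Lip_def lipschitz_on_def dist_real_def)
next
  assume "\<exists>C. \<forall>x y. \<bar>f x - f y\<bar> \<le> C * dist x y"
  then obtain C where C: "\<bar>f x - f y\<bar> \<le> C * dist x y" for x y by blast
  have "\<bar>f x - f y\<bar> \<le> max C 0 * dist x y" for x y
    using C[of x y] mult_right_mono[of C "max C 0" "dist x y"] by simp
  then have "(max C 0)-lipschitz_on UNIV f"
    by (auto simp: lipschitz_on_def dist_real_def)
  then show "f \<in> Lip" by (auto simp: Lip_def)
qed

lemma Lip_const: "(\<lambda>x. c) \<in> Lip"
  unfolding Lip_iff by (rule exI[of _ 0]) simp

lemma Lip_add: assumes "f \<in> Lip" "g \<in> Lip" shows "(\<lambda>x. f x + g x) \<in> Lip"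
proof -
  obtain C where C: "\<bar>f x - f y\<bar> \<le> C * dist x y" for x y using assms by (auto simp: Lip_iff)
  obtain D where D: "\<bar>g x - g y\<bar> \<le> D * dist x y" for x y using assms by (auto simp: Lip_iff)
  have "\<bar>(f x + g x) - (f y + g y)\<bar> \<le> (C + D) * dist x y" for x y
    using C[of x y] D[of x y] by (simp add: distrib_right)
  then show ?thesis unfolding Lip_iff by blast
qed

lemma Lip_scale: assumes "f \<in> Lip" shows "(\<lambda>x. c * f x) \<in> Lip"
proof -
  obtain C where C: "\<bar>f x - f y\<bar> \<le> C * dist x y" for x y using assms by (auto simp: Lip_iff)
  have "\<bar>c * f x - c * f y\<bar> \<le> (\<bar>c\<bar> * C) * dist x y" for x y
    using mult_left_mono[OF C[of x y], of "\<bar>c\<bar>"]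
    by (simp add: abs_mult[symmetric] right_diff_distrib mult.assoc)
  then show ?thesis unfolding Lip_iff by blast
qed

lemma Lip_minus: "f \<in> Lip \<Longrightarrow> (\<lambda>x. - f x) \<in> Lip"
  using Lip_scale[of f "-1"] by simp

lemma Lip_diff: "f \<in> Lip \<Longrightarrow> g \<in> Lip \<Longrightarrow> (\<lambda>x. f x - g x) \<in> Lip"
  using Lip_add[of f "\<lambda>x. - g x"] Lip_minus[of g] by simp

definition eq_mod_const :: "('x::metric_space \<Rightarrow> real) \<Rightarrow> ('x \<Rightarrow> real) \<Rightarrow> bool" where
  "eq_mod_const f g \<longleftrightarrow> f \<in> Lip \<and> g \<in> Lip \<and> (\<exists>c. \<forall>x. f x - g x = c)"

quotient_type (overloaded) 'x lipq = "'x::metric_space \<Rightarrow> real" / partial: eq_mod_const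
proof (rule part_equivpI)
  show "\<exists>f :: 'x \<Rightarrow> real. eq_mod_const f f"
    by (rule exI[of _ "\<lambda>x. 0"]) (simp add: eq_mod_const_def Lip_const)
  show "symp (eq_mod_const :: ('x \<Rightarrow> real) \<Rightarrow> _)"
  proof (rule sympI)
    fix f g :: "'x \<Rightarrow> real"
    assume "eq_mod_const f g"
    then obtain c where "f \<in> Lip" "g \<in> Lip" and c: "f x - g x = c" for x
      by (auto simp: eq_mod_const_def)
    moreover have "g x - f x = - c" for x using c[of x] by simp
    ultimately show "eq_mod_const g f" by (auto simp: eq_mod_const_def)
  qed
  show "transp (eq_mod_const :: ('x \<Rightarrow> real) \<Rightarrow> _)"
  proof (rule transpI)
    fix f g h :: "'x \<Rightarrow> real"
    assume "eq_mod_const f g" "eq_mod_const g h"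
    then obtain c d where "f \<in> Lip" "h \<in> Lip"
      and c: "f x - g x = c" and d: "g x - h x = d" for x
      by (auto simp: eq_mod_const_def)
    moreover have "f x - h x = c + d" for x using c[of x] d[of x] by simp
    ultimately show "eq_mod_const f h" by (auto simp: eq_mod_const_def)
  qed
qed

text \<open>
  The supremum ranges over all pairs: those with \<open>x = y\<close> contribute \<open>0 / 0 = 0\<close>, which also makes the
  supremum \<open>0\<close> on a one-point space, where there are no pairs with \<open>x \<noteq> y\<close>.
\<close>

definition lip_const :: "('x::metric_space \<Rightarrow> real) \<Rightarrow> real" where
  "lip_const f = (SUP (x, y). \<bar>f x - f y\<bar> / dist x y)"

lemma lip_const_bdd:
  assumes "f \<in> Lip"
  shows "bdd_above (range (\<lambda>(x, y). \<bar>f x - f y\<bar> / dist x y))"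
proof -
  obtain C where C: "\<bar>f x - f y\<bar> \<le> C * dist x y" for x y using assms by (auto simp: Lip_iff)
  have "\<bar>f x - f y\<bar> / dist x y \<le> max C 0" for x y
  proof (cases "x = y")
    case False
    then have "\<bar>f x - f y\<bar> / dist x y \<le> C" using C[of x y] by (simp add: pos_divide_le_eq)
    then show ?thesis by simp
  qed simp
  then show ?thesis by (intro bdd_aboveI[where M = "max C 0"]) auto
qed

lemma lip_const_upper:
  assumes "f \<in> Lip"
  shows "\<bar>f x - f y\<bar> \<le> lip_const f * dist x y"
proof (cases "x = y")
  case False
  have "\<bar>f x - f y\<bar> / dist x y \<le> lip_const f"
    unfolding lip_const_def using cSUP_upper[OF _ lip_const_bdd[OF assms], of "(x, y)"] by simp
  then show ?thesis using False by (simp add: pos_divide_le_eq)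
qed simp

lemma lip_const_least:
  assumes "\<And>x y. \<bar>f x - f y\<bar> \<le> C * dist x y" and "0 \<le> C"
  shows "lip_const f \<le> C"
  unfolding lip_const_def
proof (rule cSUP_least)
  fix p :: "'a \<times> 'a"
  show "(case p of (x, y) \<Rightarrow> \<bar>f x - f y\<bar> / dist x y) \<le> C"
  proof (cases p)
    case (Pair x y)
    then show ?thesis
      using assms(1)[of x y] assms(2) by (cases "x = y") (auto simp: pos_divide_le_eq)
  qed
qed simp

lemma lip_const_nonneg:
  assumes "f \<in> Lip" shows "0 \<le> lip_const f"
  unfolding lip_const_def
  using cSUP_upper[OF _ lip_const_bdd[OF assms], of "(undefined, undefined)"] by simp

lemma lip_const_scale:
  assumes "f \<in> Lip" shows "lip_const (\<lambda>x. c * f x) = \<bar>c\<bar> * lip_const f"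
proof -
  have le: "lip_const (\<lambda>x. a * h x) \<le> \<bar>a\<bar> * lip_const h" if h: "h \<in> Lip" for a and h :: "'a \<Rightarrow> real"
  proof (rule lip_const_least)
    show "\<bar>a * h x - a * h y\<bar> \<le> \<bar>a\<bar> * lip_const h * dist x y" for x y
      using mult_left_mono[OF lip_const_upper[OF h, of x y], of "\<bar>a\<bar>"]
      by (simp add: abs_mult[symmetric] right_diff_distrib mult.assoc)
    show "0 \<le> \<bar>a\<bar> * lip_const h" using lip_const_nonneg[OF h] by simp
  qed
  show ?thesis
  proof (cases "c = 0")
    case True
    then show ?thesis using le[OF assms, of c] lip_const_nonneg[OF Lip_scale[OF assms, of c]] by simp
  next
    case False
    have "lip_const f \<le> \<bar>inverse c\<bar> * lip_const (\<lambda>x. c * f x)"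
      using le[OF Lip_scale[OF assms, of c], of "inverse c"] False by (simp add: mult.assoc[symmetric])
    then have "\<bar>c\<bar> * lip_const f \<le> lip_const (\<lambda>x. c * f x)"
      using False by (simp add: field_simps)
    then show ?thesis using le[OF assms, of c] by simp
  qed
qed

instantiation lipq :: (metric_space) real_normed_vector
begin

lift_definition zero_lipq :: "'a lipq" is "\<lambda>x. 0"
  by (simp add: eq_mod_const_def Lip_const)

lift_definition plus_lipq :: "'a lipq \<Rightarrow> 'a lipq \<Rightarrow> 'a lipq" is "\<lambda>f g x. f x + g x"
proof -
  fix f f' g g' :: "'a \<Rightarrow> real"
  assume "eq_mod_const f f'" "eq_mod_const g g'"
  then obtain c d where "f \<in> Lip" "f' \<in> Lip" "g \<in> Lip" "g' \<in> Lip"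
    and "\<And>x. f x - f' x = c" "\<And>x. g x - g' x = d"
    by (auto simp: eq_mod_const_def)
  moreover from this have "(f x + g x) - (f' x + g' x) = c + d" for x
    by (metis add_diff_add)
  ultimately show "eq_mod_const (\<lambda>x. f x + g x) (\<lambda>x. f' x + g' x)"
    by (auto simp: eq_mod_const_def intro!: Lip_add)
qed

lift_definition uminus_lipq :: "'a lipq \<Rightarrow> 'a lipq" is "\<lambda>f x. - f x"
proof -
  fix f f' :: "'a \<Rightarrow> real"
  assume "eq_mod_const f f'"
  then obtain c where "f \<in> Lip" "f' \<in> Lip" and c: "\<And>x. f x - f' x = c"
    by (auto simp: eq_mod_const_def)
  moreover have "- f x - - f' x = - c" for x using c[of x] by simp
  ultimately show "eq_mod_const (\<lambda>x. - f x) (\<lambda>x. - f' x)"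
    unfolding eq_mod_const_def by (blast intro: Lip_minus)
qed

lift_definition minus_lipq :: "'a lipq \<Rightarrow> 'a lipq \<Rightarrow> 'a lipq" is "\<lambda>f g x. f x - g x"
proof -
  fix f f' g g' :: "'a \<Rightarrow> real"
  assume "eq_mod_const f f'" "eq_mod_const g g'"
  then obtain c d where "f \<in> Lip" "f' \<in> Lip" "g \<in> Lip" "g' \<in> Lip"
    and c: "\<And>x. f x - f' x = c" and d: "\<And>x. g x - g' x = d"
    by (auto simp: eq_mod_const_def)
  moreover have "(f x - g x) - (f' x - g' x) = c - d" for x using c[of x] d[of x] by simp
  ultimately show "eq_mod_const (\<lambda>x. f x - g x) (\<lambda>x. f' x - g' x)"
    unfolding eq_mod_const_def by (blast intro: Lip_diff)
qed

lift_definition scaleR_lipq :: "real \<Rightarrow> 'a lipq \<Rightarrow> 'a lipq" is "\<lambda>r f x. r * f x"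
proof -
  fix r :: real and f f' :: "'a \<Rightarrow> real"
  assume "eq_mod_const f f'"
  then obtain c where "f \<in> Lip" "f' \<in> Lip" and c: "\<And>x. f x - f' x = c"
    by (auto simp: eq_mod_const_def)
  moreover have "r * f x - r * f' x = r * c" for x
    using c[of x] by (simp add: right_diff_distrib[symmetric])
  ultimately show "eq_mod_const (\<lambda>x. r * f x) (\<lambda>x. r * f' x)"
    unfolding eq_mod_const_def by (blast intro: Lip_scale)
qed

lift_definition norm_lipq :: "'a lipq \<Rightarrow> real" is lip_const
proof -
  fix f f' :: "'a \<Rightarrow> real"
  assume "eq_mod_const f f'"
  then obtain c where c: "\<And>x. f x - f' x = c" by (auto simp: eq_mod_const_def)
  have "f x - f y = f' x - f' y" for x y using c[of x] c[of y] by simp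
  then show "lip_const f = lip_const f'" by (simp add: lip_const_def)
qed

definition dist_lipq :: "'a lipq \<Rightarrow> 'a lipq \<Rightarrow> real" where
  "dist_lipq \<phi> \<psi> = norm (\<phi> - \<psi>)"

definition sgn_lipq :: "'a lipq \<Rightarrow> 'a lipq" where
  "sgn_lipq \<phi> = inverse (norm \<phi>) *\<^sub>R \<phi>"

definition uniformity_lipq :: "('a lipq \<times> 'a lipq) filter" where
  "uniformity_lipq = (INF e\<in>{0<..}. principal {(\<phi>, \<psi>). dist \<phi> \<psi> < e})"

definition open_lipq :: "'a lipq set \<Rightarrow> bool" where
  "open_lipq U = (\<forall>\<phi>\<in>U. eventually (\<lambda>(\<phi>', \<psi>). \<phi>' = \<phi> \<longrightarrow> \<psi> \<in> U) uniformity)"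

instance
proof
  fix a b :: real and \<phi> \<psi> \<theta> :: "'a lipq"
  show "\<phi> + \<psi> + \<theta> = \<phi> + (\<psi> + \<theta>)"
    by transfer (auto simp: eq_mod_const_def intro!: Lip_add)
  show "\<phi> + \<psi> = \<psi> + \<phi>"
    by transfer (auto simp: eq_mod_const_def intro!: Lip_add)
  show "0 + \<phi> = \<phi>"
    by transfer (auto simp: eq_mod_const_def)
  show "- \<phi> + \<phi> = 0"
    by transfer (auto simp: eq_mod_const_def intro!: Lip_const)
  show "\<phi> - \<psi> = \<phi> + - \<psi>"
    by transfer (auto simp: eq_mod_const_def intro!: Lip_diff)
  show "a *\<^sub>R (\<phi> + \<psi>) = a *\<^sub>R \<phi> + a *\<^sub>R \<psi>"
    by transfer (auto simp: eq_mod_const_def distrib_left intro!: Lip_add Lip_scale)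
  show "(a + b) *\<^sub>R \<phi> = a *\<^sub>R \<phi> + b *\<^sub>R \<phi>"
    by transfer (auto simp: eq_mod_const_def distrib_right intro!: Lip_add Lip_scale)
  show "a *\<^sub>R b *\<^sub>R \<phi> = (a * b) *\<^sub>R \<phi>"
    by transfer (auto simp: eq_mod_const_def mult.assoc[symmetric] intro!: Lip_scale)
  show "1 *\<^sub>R \<phi> = \<phi>"
    by transfer (auto simp: eq_mod_const_def)
  show "dist \<phi> \<psi> = norm (\<phi> - \<psi>)" by (rule dist_lipq_def)
  show "sgn \<phi> = inverse (norm \<phi>) *\<^sub>R \<phi>" by (rule sgn_lipq_def)
  show "uniformity = (INF e\<in>{0<..}. principal {(\<phi>, \<psi> :: 'a lipq). dist \<phi> \<psi> < e})"
    by (rule uniformity_lipq_def)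
  show "open U = (\<forall>\<phi>\<in>U. eventually (\<lambda>(\<phi>', \<psi>). \<phi>' = \<phi> \<longrightarrow> \<psi> \<in> U) uniformity)" for U :: "'a lipq set"
    by (rule open_lipq_def)
  show "norm \<phi> = 0 \<longleftrightarrow> \<phi> = 0"
  proof (transfer, rule iffI)
    fix f :: "'a \<Rightarrow> real"
    assume f: "eq_mod_const f f" and 0: "lip_const f = 0"
    then have "f x - 0 = f undefined" for x
      using lip_const_upper[of f x undefined] by (simp add: eq_mod_const_def)
    then show "eq_mod_const f (\<lambda>x. 0)"
      using f Lip_const[of 0] unfolding eq_mod_const_def by blast
  next
    fix f :: "'a \<Rightarrow> real"
    assume "eq_mod_const f (\<lambda>x. 0)"
    then obtain c where f: "f = (\<lambda>x. c)" by (auto simp: eq_mod_const_def)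
    show "lip_const f = 0" by (simp add: f lip_const_def case_prod_unfold)
  qed
  show "norm (\<phi> + \<psi>) \<le> norm \<phi> + norm \<psi>"
  proof (transfer, rule lip_const_least)
    fix f g :: "'a \<Rightarrow> real"
    assume "eq_mod_const f f" "eq_mod_const g g"
    then have fg: "f \<in> Lip" "g \<in> Lip" by (auto simp: eq_mod_const_def)
    show "\<bar>f x + g x - (f y + g y)\<bar> \<le> (lip_const f + lip_const g) * dist x y" for x y
      using lip_const_upper[OF fg(1), of x y] lip_const_upper[OF fg(2), of x y]
      by (simp add: distrib_right)
    show "0 \<le> lip_const f + lip_const g"
      using fg by (simp add: lip_const_nonneg)
  qed
  show "norm (a *\<^sub>R \<phi>) = \<bar>a\<bar> * norm \<phi>"
    by transfer (simp add: eq_mod_const_def lip_const_scale)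
qed

end

section \<open>Invariant classes, classes constant on orbits, and the operator \<open>R\<close>\<close>

lemma eq_mod_const_diff:
  assumes "eq_mod_const f f'" shows "f x - f y = f' x - f' y"
proof -
  obtain c where c: "\<And>x. f x - f' x = c" using assms by (auto simp: eq_mod_const_def)
  show ?thesis using c[of x] c[of y] by simp
qed

lift_definition is_invariant :: "('g \<Rightarrow> 'x \<Rightarrow> 'x) \<Rightarrow> 'x::metric_space lipq \<Rightarrow> bool"
  is "\<lambda>act f. \<forall>g. \<exists>c. \<forall>x. f x - f (act g x) = c"
  by (simp add: eq_mod_const_diff)

definition Lip_inv :: "('g \<Rightarrow> 'x \<Rightarrow> 'x) \<Rightarrow> 'x::metric_space lipq set" where
  "Lip_inv act = {\<phi>. is_invariant act \<phi>}"

lift_definition R :: "('g \<Rightarrow> 'x \<Rightarrow> 'x) \<Rightarrow> 'x::metric_space lipq \<Rightarrow> 'g \<Rightarrow> real"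
  is "\<lambda>act f g. THE c. \<forall>x. f x - f (act g x) = c"
  by (simp add: eq_mod_const_diff)

lift_definition constant_on_orbits :: "('g \<Rightarrow> 'x \<Rightarrow> 'x) \<Rightarrow> 'x::metric_space lipq \<Rightarrow> bool"
  is "\<lambda>act f. \<forall>x. f constant_on orbit act x"
proof -
  fix act :: "'g \<Rightarrow> 'x \<Rightarrow> 'x" and f f' :: "'x \<Rightarrow> real"
  assume "eq_mod_const f f'"
  then obtain c where "\<And>x. f x - f' x = c" by (auto simp: eq_mod_const_def)
  then have c: "f x = f' x + c" for x by (simp add: diff_eq_eq add.commute)
  have "f constant_on A \<longleftrightarrow> f' constant_on A" for A
  proof
    assume "f constant_on A"
    then obtain y where "\<forall>x\<in>A. f x = y" by (auto simp: constant_on_def)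
    then have "\<forall>x\<in>A. f' x = y - c" using c by (simp add: eq_diff_eq)
    then show "f' constant_on A" by (auto simp: constant_on_def)
  next
    assume "f' constant_on A"
    then obtain y where "\<forall>x\<in>A. f' x = y" by (auto simp: constant_on_def)
    then have "\<forall>x\<in>A. f x = y + c" using c by simp
    then show "f constant_on A" by (auto simp: constant_on_def)
  qed
  then show "(\<forall>x. f constant_on orbit act x) = (\<forall>x. f' constant_on orbit act x)"
    by simp
qed

section \<open>\<open>Hom(G, \<real>)\<close> and the rank of a linear operator\<close>

instantiation "fun" :: (type, real_vector) real_vector
begin

definition scaleR_fun :: "real \<Rightarrow> ('a \<Rightarrow> 'b) \<Rightarrow> 'a \<Rightarrow> 'b" where
  "scaleR_fun r f = (\<lambda>x. r *\<^sub>R f x)"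

instance
  by standard (simp_all add: scaleR_fun_def fun_eq_iff scaleR_add_right scaleR_add_left)

end

definition Hom :: "('g::topological_group_add \<Rightarrow> real) set" where
  "Hom = {h. continuous_on UNIV h \<and> (\<forall>a b. h (a + b) = h a + h b)}"

text \<open>
  The library's \<^const>\<open>dim\<close> is \<open>0\<close> on infinite-dimensional spaces, so the rank is not defined
  through it.
\<close>

definition has_rank :: "('a::real_vector \<Rightarrow> 'b::real_vector) \<Rightarrow> 'a set \<Rightarrow> nat \<Rightarrow> bool" where
  "has_rank T V n \<longleftrightarrow>
     (\<exists>B. finite B \<and> card B = n \<and> independent B \<and> span B = T ` V)"

text \<open>\<open>Lip_inv act\<close> is a subspace, and \<open>R act\<close> is linear from it to the space \<open>Hom\<close>.\<close>

lift_definition ldiff :: "'x::metric_space lipq \<Rightarrow> 'x \<Rightarrow> 'x \<Rightarrow> real" is "\<lambda>f x y. f x - f y"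
  by (intro ext eq_mod_const_diff)

lemma ldiff_simps [simp]:
  "ldiff 0 x y = 0"
  "ldiff (\<phi> + \<psi>) x y = ldiff \<phi> x y + ldiff \<psi> x y"
  "ldiff (r *\<^sub>R \<phi>) x y = r * ldiff \<phi> x y"
  by (transfer; simp add: algebra_simps)+

lemma Lip_inv_iff: "\<phi> \<in> Lip_inv act \<longleftrightarrow> (\<forall>g. \<exists>c. \<forall>x. ldiff \<phi> x (act g x) = c)"
  unfolding Lip_inv_def mem_Collect_eq by transfer simp

lemma R_eq:
  assumes "\<phi> \<in> Lip_inv act"
  shows "R act \<phi> g = ldiff \<phi> x (act g x)"
proof -
  have R: "R act \<phi> g = (THE c. \<forall>x. ldiff \<phi> x (act g x) = c)"
    by transfer simp
  obtain c where c: "\<forall>x. ldiff \<phi> x (act g x) = c"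
    using assms by (auto simp: Lip_inv_iff)
  then show ?thesis unfolding R by (intro the_equality) auto
qed

lemma subspace_Lip_inv: "subspace (Lip_inv act)"
proof (rule subspaceI)
  fix \<phi> \<psi> :: "'a lipq" and r :: real
  show "0 \<in> Lip_inv act" by (simp add: Lip_inv_iff)
  assume \<phi>: "\<phi> \<in> Lip_inv act"
  have "ldiff (r *\<^sub>R \<phi>) x (act g x) = r * R act \<phi> g" for g x
    using R_eq[OF \<phi>, of g x] by simp
  then show "r *\<^sub>R \<phi> \<in> Lip_inv act" by (auto simp: Lip_inv_iff simp del: ldiff_simps)
  assume \<psi>: "\<psi> \<in> Lip_inv act"
  have "ldiff (\<phi> + \<psi>) x (act g x) = R act \<phi> g + R act \<psi> g" for g x
    using R_eq[OF \<phi>, of g x] R_eq[OF \<psi>, of g x] by simp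
  then show "\<phi> + \<psi> \<in> Lip_inv act" by (auto simp: Lip_inv_iff simp del: ldiff_simps)
qed

lemma R_add:
  assumes "\<phi> \<in> Lip_inv act" "\<psi> \<in> Lip_inv act"
  shows "R act (\<phi> + \<psi>) = R act \<phi> + R act \<psi>"
proof
  fix g
  show "R act (\<phi> + \<psi>) g = (R act \<phi> + R act \<psi>) g"
    using R_eq[OF assms(1), of g undefined] R_eq[OF assms(2), of g undefined]
      R_eq[OF subspace_add[OF subspace_Lip_inv assms], of g undefined]
    by simp
qed

lemma R_scaleR:
  assumes "\<phi> \<in> Lip_inv act"
  shows "R act (r *\<^sub>R \<phi>) = r *\<^sub>R R act \<phi>"
proof
  fix g
  show "R act (r *\<^sub>R \<phi>) g = (r *\<^sub>R R act \<phi>) g"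
    using R_eq[OF assms, of g undefined]
      R_eq[OF subspace_scale[OF subspace_Lip_inv assms], of r g undefined]
    by (simp add: scaleR_fun_def)
qed

lemma subspace_Hom: "subspace (Hom :: ('g::topological_group_add \<Rightarrow> real) set)"
proof (rule subspaceI)
  fix h k :: "'g \<Rightarrow> real" and r :: real
  have "continuous_on UNIV (\<lambda>x::'g. 0::real)" by (rule continuous_on_const)
  then show "0 \<in> (Hom :: ('g \<Rightarrow> real) set)" by (simp add: Hom_def zero_fun_def)
  assume h: "h \<in> Hom"
  then have "continuous_on UNIV (\<lambda>x. r * h x)"
    by (intro continuous_on_mult_left) (simp add: Hom_def)
  with h show "r *\<^sub>R h \<in> Hom" by (simp add: Hom_def scaleR_fun_def distrib_left)
  assume k: "k \<in> Hom"
  with h have "continuous_on UNIV (\<lambda>x. h x + k x)"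
    by (intro continuous_on_add) (simp_all add: Hom_def)
  with h k show "h + k \<in> Hom" by (simp add: Hom_def plus_fun_def)
qed

lemma R_in_Hom:
  fixes act :: "'g::topological_group_add \<Rightarrow> 'x::metric_space \<Rightarrow> 'x"
  assumes act: "continuous_isometric_action act" and \<phi>: "\<phi> \<in> Lip_inv act"
  shows "R act \<phi> \<in> Hom"
proof -
  fix x :: 'x
  have "eq_mod_const (rep_lipq \<phi>) (rep_lipq \<phi>)"
    by (rule Quotient3_rep_reflp[OF Quotient3_lipq])
  then obtain C where "C-lipschitz_on UNIV (rep_lipq \<phi>)"
    by (auto simp: eq_mod_const_def Lip_def)
  then have cont: "continuous_on UNIV (rep_lipq \<phi>)"
    by (rule lipschitz_on_continuous_on)
  have joint: "continuous_on UNIV (\<lambda>(g, x). act g x)"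
    using act by (simp add: continuous_isometric_action_def)
  have "continuous_on UNIV (\<lambda>g::'g. (g, x))"
    by (intro continuous_on_Pair continuous_on_id continuous_on_const)
  from continuous_on_compose2[OF joint this subset_UNIV]
  have orb: "continuous_on UNIV (\<lambda>g. act g x)" by simp
  have eq: "R act \<phi> = (\<lambda>g. rep_lipq \<phi> x - rep_lipq \<phi> (act g x))"
    using R_eq[OF \<phi>, of _ x] by (simp add: fun_eq_iff ldiff.rep_eq)
  have "continuous_on UNIV (R act \<phi>)"
    unfolding eq
    by (intro continuous_on_diff continuous_on_const continuous_on_compose2[OF cont orb subset_UNIV])
  moreover have "R act \<phi> (a + b) = R act \<phi> a + R act \<phi> b" for a b
    using R_eq[OF \<phi>, of "a + b" x] R_eq[OF \<phi>, of b x] R_eq[OF \<phi>, of a "act b x"] act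
    by (simp add: ldiff.rep_eq continuous_isometric_action_def)
  ultimately show ?thesis by (simp add: Hom_def)
qed

section \<open>Complemented subspaces\<close>

definition one_complemented :: "'a::real_normed_vector set \<Rightarrow> bool" where
  "one_complemented S \<longleftrightarrow> subspace S \<and> closed S \<and>
     (\<exists>P :: 'a \<Rightarrow> 'a. bounded_linear P \<and> P \<circ> P = P \<and> onorm P \<le> 1 \<and> range P = S)"

end

(* Averaging g \<mapsto> \<phi> (act g x) - \<phi> (act g y) against an invariant mean gives a difference function
   D x y which is additive in (x, y), bounded by L(\<phi>) * dist x y and invariant under the diagonal
   action; it is therefore the difference function of a class in Lip_inv of norm at most L(\<phi>). As R
   vanishes, this class is constant on orbits, and a class that already has this property makes
   the averaged functions constant, so it is left fixed. *)
theory Submission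
  imports Defs
begin

lemma LUCB_const: "(\<lambda>x. c) \<in> LUCB"
  unfolding LUCB_def by (auto intro: uniform_limit_const)

lemma LUCB_scale:
  assumes "\<phi> \<in> LUCB" shows "(\<lambda>x. c * \<phi> x) \<in> LUCB"
proof -
  from assms have "bounded ((\<lambda>y. c *\<^sub>R y) ` range \<phi>)"
    by (intro bounded_scaling) (simp add: LUCB_def)
  then have "bounded (range (\<lambda>x. c * \<phi> x))" by (simp add: image_image)
  moreover have "uniform_limit UNIV (\<lambda>h x. c * \<phi> (x + h)) (\<lambda>x. c * \<phi> (x + g)) (nhds g)" for g
    using assms
    by (auto simp: LUCB_def intro: bounded_linear.uniform_limit[OF bounded_linear_mult_right])
  ultimately show ?thesis by (simp add: LUCB_def)
qed

text \<open>Both C + \<phi> and C - \<phi> are nonnegative, and linearity sends the constant C to C,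
  so positivity yields the two one-sided bounds.\<close>

lemma mean_abs_le:
  assumes m: "is_mean m" and \<phi>: "\<phi> \<in> LUCB" and le: "\<And>x. \<bar>\<phi> x\<bar> \<le> C"
  shows "\<bar>m \<phi>\<bar> \<le> C"
proof -
  have add: "m (\<lambda>x. \<psi> x + \<theta> x) = m \<psi> + m \<theta>" if "\<psi> \<in> LUCB" "\<theta> \<in> LUCB" for \<psi> \<theta>
    using m that by (simp add: is_mean_def)
  have scale: "m (\<lambda>x. c * \<psi> x) = c * m \<psi>" if "\<psi> \<in> LUCB" for c \<psi>
    using m that by (simp add: is_mean_def)
  have const: "m (\<lambda>x. C) = C"
    using scale[OF LUCB_const[of 1], of C] m by (simp add: is_mean_def)
  have pos: "0 \<le> m \<psi>" if "\<psi> \<in> LUCB" "\<forall>x. 0 \<le> \<psi> x" for \<psi>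
    using m that by (simp add: is_mean_def)
  have LUCB_add_const: "(\<lambda>x. C + \<psi> x) \<in> LUCB" if "\<psi> \<in> LUCB" for \<psi>
  proof -
    have "bounded ((\<lambda>y. C + y) ` range \<psi>)"
      using that by (intro bounded_translation) (simp add: LUCB_def)
    then have "bounded (range (\<lambda>x. C + \<psi> x))" by (simp add: image_image)
    then show ?thesis
      using that by (auto simp: LUCB_def intro: uniform_limit_add uniform_limit_const)
  qed
  have nonneg: "0 \<le> C + m \<psi>" if "\<psi> \<in> LUCB" "\<And>x. 0 \<le> C + \<psi> x" for \<psi>
  proof -
    have "0 \<le> m (\<lambda>x. C + \<psi> x)"
      using that by (intro pos LUCB_add_const allI)
    then show ?thesis using add[OF LUCB_const that(1), of C] const by simp
  qed
  \<comment> \<open>The negative is written \<open>- 1 * \<phi> x\<close> so that the homogeneity of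
    \<open>m\<close> on \<open>LUCB\<close> applies to it.\<close>
  have "0 \<le> C + \<phi> x" "0 \<le> C + - 1 * \<phi> x" for x
    using le[of x] by (simp_all add: abs_le_iff)
  then have "0 \<le> C + m \<phi>" "0 \<le> C + m (\<lambda>x. - 1 * \<phi> x)"
    using nonneg[OF \<phi>] nonneg[OF LUCB_scale[OF \<phi>, of "- 1"]] by simp_all
  then show ?thesis using scale[OF \<phi>, of "-1"] by (simp add: abs_le_iff)
qed

text \<open>Differences forget exactly the additive constant. Identities between classes can thus be
  checked through \<open>ldiff\<close>, without choosing representatives.\<close>

lemma lipq_eqI:
  assumes "\<And>x y. ldiff \<phi> x y = ldiff \<psi> x y"
  shows "\<phi> = \<psi>"
  using assms
proof transfer
  fix f g :: "'a \<Rightarrow> real"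
  assume fg: "eq_mod_const f f" "eq_mod_const g g" and eq: "\<And>x y. f x - f y = g x - g y"
  have "f x - g x = f undefined - g undefined" for x using eq[of x undefined] by simp
  then show "eq_mod_const f g" using fg unfolding eq_mod_const_def by blast
qed

lemma ldiff_trans: "ldiff \<phi> x y - ldiff \<phi> z y = ldiff \<phi> x z"
  by transfer simp

lemma abs_ldiff_le: "\<bar>ldiff \<phi> x y\<bar> \<le> norm \<phi> * dist x y"
  by transfer (simp add: lip_const_upper eq_mod_const_def)

lemma norm_lipq_le:
  assumes "\<And>x y. \<bar>ldiff \<phi> x y\<bar> \<le> C * dist x y" and "0 \<le> C"
  shows "norm \<phi> \<le> C"
  using assms by transfer (rule lip_const_least)

text \<open>Fixing an arbitrary base point, here \<open>undefined\<close>, in the second argument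
  gives a representative: the cocycle identity recovers D from its differences, and the bound on D
  makes it Lipschitz.\<close>

lemma ex_lipq_of_differences:
  fixes D :: "'x::metric_space \<Rightarrow> 'x \<Rightarrow> real"
  assumes trans: "\<And>x y z. D x y - D z y = D x z" and le: "\<And>x y. \<bar>D x y\<bar> \<le> C * dist x y"
  shows "\<exists>\<phi>. \<forall>x y. ldiff \<phi> x y = D x y"
proof -
  have "(\<lambda>x. D x undefined) \<in> Lip"
    unfolding Lip_iff using trans le by auto
  then have "eq_mod_const (\<lambda>x. D x undefined) (\<lambda>x. D x undefined)"
    by (simp add: eq_mod_const_def)
  then have "ldiff (abs_lipq (\<lambda>x. D x undefined)) x y = D x y" for x y
    by (simp add: ldiff.abs_eq trans)
  then show ?thesis by blast
qed

text \<open>Since the neutral element fixes x, the point x lies in its own orbit, so the constant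
  value on that orbit is the value at x.\<close>

lemma constant_on_orbits_iff:
  assumes "\<And>x. act (0::'g::topological_group_add) x = x"
  shows "constant_on_orbits act \<phi> \<longleftrightarrow> (\<forall>x g. ldiff \<phi> x (act g x) = 0)"
  using assms
proof transfer
  fix act :: "'g \<Rightarrow> 'a \<Rightarrow> 'a" and f :: "'a \<Rightarrow> real"
  assume 0: "\<And>x. act 0 x = x"
  show "(\<forall>x. f constant_on orbit act x) \<longleftrightarrow> (\<forall>x g. f x - f (act g x) = 0)"
  proof (intro iffI allI)
    fix x g
    assume "\<forall>x. f constant_on orbit act x"
    then obtain c where c: "\<And>h. f (act h x) = c" by (auto simp: constant_on_def orbit_def)
    then show "f x - f (act g x) = 0" using c[of 0] by (simp add: 0)
  next
    fix x
    assume "\<forall>x g. f x - f (act g x) = 0"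
    then show "f constant_on orbit act x" by (auto simp: constant_on_def orbit_def)
  qed
qed

text \<open>Boundedness holds because g preserves the distance from x to y. Uniform continuity under
  right translation holds because (k + h) x and (k + g) x are images under k of h x and g x, so
  their distance does not depend on k.\<close>

lemma orbit_difference_LUCB:
  fixes act :: "'g::topological_group_add \<Rightarrow> 'x::metric_space \<Rightarrow> 'x"
  assumes act: "continuous_isometric_action act"
  shows "(\<lambda>g. ldiff \<phi> (act g x) (act g y)) \<in> LUCB"
proof -
  have assoc: "act (g + h) z = act g (act h z)" and iso: "dist (act g z) (act g w) = dist z w"
    for g h z w using act by (simp_all add: continuous_isometric_action_def)
  have joint: "continuous_on UNIV (\<lambda>(g, x). act g x)"
    using act by (simp add: continuous_isometric_action_def)
  have "continuous_on UNIV (\<lambda>g. act g z)" for z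
    using continuous_on_compose2[OF joint, of UNIV "\<lambda>g. (g, z)"]
    by (simp add: continuous_on_Pair)
  then have lim: "((\<lambda>h. act h z) \<longlongrightarrow> act g z) (nhds g)" for g z
    by (simp add: continuous_on_def tendsto_nhds_iff)
  have "uniform_limit UNIV (\<lambda>h k. ldiff \<phi> (act (k + h) x) (act (k + h) y))
          (\<lambda>k. ldiff \<phi> (act (k + g) x) (act (k + g) y)) (nhds g)" for g
  proof (rule uniform_limitI)
    fix e :: real
    assume e: "0 < e"
    have bound: "dist (ldiff \<phi> (act (k + h) x) (act (k + h) y)) (ldiff \<phi> (act (k + g) x) (act (k + g) y))
      \<le> norm \<phi> * (dist (act h x) (act g x) + dist (act h y) (act g y))" for h k
    proof -
      \<comment> \<open>Regrouping pairs the two translates of x and the two translates of y; their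
        distances, unlike that from x to y, become small as h tends to g.\<close>
      have "ldiff \<phi> (act (k + h) x) (act (k + h) y) - ldiff \<phi> (act (k + g) x) (act (k + g) y)
          = ldiff \<phi> (act (k + h) x) (act (k + g) x) - ldiff \<phi> (act (k + h) y) (act (k + g) y)"
        by transfer simp
      then show ?thesis
        using abs_ldiff_le[of \<phi> "act (k + h) x" "act (k + g) x"]
          abs_ldiff_le[of \<phi> "act (k + h) y" "act (k + g) y"]
        by (simp add: dist_real_def assoc iso distrib_left)
    qed
    \<comment> \<open>The limit is 0, written out in the form that the limit rules produce.\<close>
    have "((\<lambda>h. norm \<phi> * (dist (act h x) (act g x) + dist (act h y) (act g y))) \<longlongrightarrow>
        norm \<phi> * (dist (act g x) (act g x) + dist (act g y) (act g y))) (nhds g)"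
      by (intro tendsto_intros lim)
    then have "\<forall>\<^sub>F h in nhds g.
        norm \<phi> * (dist (act h x) (act g x) + dist (act h y) (act g y)) < e"
      using e by (auto dest: order_tendstoD(2))
    then show "\<forall>\<^sub>F h in nhds g. \<forall>k\<in>UNIV.
        dist (ldiff \<phi> (act (k + h) x) (act (k + h) y)) (ldiff \<phi> (act (k + g) x) (act (k + g) y)) < e"
      by eventually_elim (use bound in \<open>blast intro: le_less_trans\<close>)
  qed
  moreover have "bounded (range (\<lambda>g. ldiff \<phi> (act g x) (act g y)))"
  proof (rule boundedI)
    fix r
    assume "r \<in> range (\<lambda>g. ldiff \<phi> (act g x) (act g y))"
    then obtain g where "r = ldiff \<phi> (act g x) (act g y)" by blast
    then show "norm r \<le> norm \<phi> * dist x y"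
      using abs_ldiff_le[of \<phi> "act g x" "act g y"] by (simp add: iso)
  qed
  ultimately show ?thesis by (simp add: LUCB_def)
qed

theorem mainTheorem10:
  fixes act :: "'g::topological_group_add \<Rightarrow> 'x::metric_space \<Rightarrow> 'x"
  assumes "amenable TYPE('g)"
    and "continuous_isometric_action act"
    and "has_rank (R act) (Lip_inv act) 0"
  shows "one_complemented {\<phi> :: 'x lipq. constant_on_orbits act \<phi>}"
proof -
  obtain m :: "('g \<Rightarrow> real) \<Rightarrow> real" where m: "is_mean m"
    and inv: "\<And>\<phi> g. \<phi> \<in> LUCB \<Longrightarrow> m (\<lambda>x. \<phi> (x + g)) = m \<phi>"
    using assms(1) unfolding amenable_def by blast
  have zero: "act 0 z = z" and assoc: "act (g + h) z = act g (act h z)"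
    and iso: "dist (act g z) (act g w) = dist z w" for g h z w
    using assms(2) by (simp_all add: continuous_isometric_action_def)
  \<comment> \<open>Differences are averaged rather than values: they depend only on the class and
    are bounded along the action, while a Lipschitz function may be unbounded on an orbit.\<close>
  define D where "D \<phi> x y = m (\<lambda>g. ldiff \<phi> (act g x) (act g y))" for \<phi> x y
  note LUCB = orbit_difference_LUCB[OF assms(2)]
  have m_add: "m (\<lambda>x. \<psi> x + \<theta> x) = m \<psi> + m \<theta>" if "\<psi> \<in> LUCB" "\<theta> \<in> LUCB" for \<psi> \<theta>
    using m that by (simp add: is_mean_def)
  have m_scale: "m (\<lambda>x. c * \<psi> x) = c * m \<psi>" if "\<psi> \<in> LUCB" for c \<psi>
    using m that by (simp add: is_mean_def)
  have D_le: "\<bar>D \<phi> x y\<bar> \<le> norm \<phi> * dist x y" for \<phi> x y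
    unfolding D_def
  proof (rule mean_abs_le[OF m LUCB])
    show "\<bar>ldiff \<phi> (act g x) (act g y)\<bar> \<le> norm \<phi> * dist x y" for g
      using abs_ldiff_le[of \<phi> "act g x" "act g y"] by (simp add: iso)
  qed
  have D_trans: "D \<phi> x y - D \<phi> z y = D \<phi> x z" for \<phi> x y z
  proof -
    have "ldiff \<phi> u v = ldiff \<phi> u w + ldiff \<phi> w v" for u v w
      using ldiff_trans[of \<phi> u v w] by simp
    \<comment> \<open>The point g z is inserted between g x and g y under the mean.\<close>
    then have "D \<phi> x y = m (\<lambda>g. ldiff \<phi> (act g x) (act g z) + ldiff \<phi> (act g z) (act g y))"
      unfolding D_def by (intro arg_cong[where f = m] ext)
    also have "\<dots> = D \<phi> x z + D \<phi> z y"
      unfolding D_def by (intro m_add LUCB)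
    finally show ?thesis by simp
  qed
  \<comment> \<open>Moving x and y by h turns g x into (g + h) x, a right translation of the
    averaged function, which is the side on which \<open>m\<close> is invariant.\<close>
  have D_inv: "D \<phi> (act h x) (act h y) = D \<phi> x y" for \<phi> h x y
    using inv[OF LUCB[of \<phi> x y], of h] by (simp add: D_def assoc)
  have "\<forall>\<phi>. \<exists>\<psi>. \<forall>x y. ldiff \<psi> x y = D \<phi> x y"
    using ex_lipq_of_differences[OF D_trans D_le] by blast
  then obtain P where P: "\<And>\<phi> x y. ldiff (P \<phi>) x y = D \<phi> x y" by metis
  let ?S = "{\<phi>. constant_on_orbits act \<phi>}"
  have S_iff: "\<phi> \<in> ?S \<longleftrightarrow> (\<forall>x g. ldiff \<phi> x (act g x) = 0)" for \<phi>
    by (simp add: constant_on_orbits_iff zero)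
  \<comment> \<open>A basis with no elements is empty, and its span is {0}.\<close>
  have "R act ` Lip_inv act = {0}"
    using assms(3) by (auto simp: has_rank_def)
  then have R0: "R act \<phi> = 0" if "\<phi> \<in> Lip_inv act" for \<phi>
    using that by blast
  have P_S: "P \<phi> \<in> ?S" for \<phi>
  proof -
    \<comment> \<open>Going from x to g x through y and g y gives D(x, y) + D(y, gy) + D(gy, gx).
      The outer terms cancel by invariance and antisymmetry; the degenerate instances of
      \<open>D_trans\<close> supply D(gx, gx) = 0 and the antisymmetry.\<close>
    have "D \<phi> x (act g x) = D \<phi> y (act g y)" for g x y
      using D_trans[of \<phi> x "act g x" y] D_trans[of \<phi> y "act g x" "act g y"]
        D_trans[of \<phi> "act g x" "act g x" "act g x"] D_trans[of \<phi> "act g x" "act g x" "act g y"]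
        D_inv[of \<phi> g x y] by linarith
    then have "P \<phi> \<in> Lip_inv act" unfolding Lip_inv_iff P by blast
    \<comment> \<open>The common value of these differences is \<open>R act (P \<phi>) g\<close>,
      which is 0.\<close>
    then show ?thesis unfolding S_iff using R_eq R0 by (metis zero_fun_def)
  qed
  have P_id: "P \<phi> = \<phi>" if "\<phi> \<in> ?S" for \<phi>
  proof (rule lipq_eqI)
    fix x y
    have "ldiff \<phi> (act g x) (act g y) = ldiff \<phi> x y" for g
    proof -
      have "ldiff \<phi> x (act g x) = 0" "ldiff \<phi> y (act g y) = 0"
        using that S_iff by blast+
      then show ?thesis by transfer simp
    qed
    \<comment> \<open>The averaged function is the constant \<open>ldiff \<phi> x y\<close>, seen as
      a multiple of 1, and \<open>m\<close> sends 1 to 1.\<close>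
    then show "ldiff (P \<phi>) x y = ldiff \<phi> x y"
      using m_scale[OF LUCB_const[of 1], of "ldiff \<phi> x y"] m by (simp add: P D_def is_mean_def)
  qed
  have norm_P: "norm (P \<phi>) \<le> norm \<phi>" for \<phi>
    by (rule norm_lipq_le) (simp_all add: P D_le)
  have "bounded_linear P"
  proof (rule bounded_linear_intro[where K = 1])
    show "P (\<phi> + \<psi>) = P \<phi> + P \<psi>" for \<phi> \<psi>
      by (rule lipq_eqI) (simp add: P D_def m_add LUCB)
    show "P (r *\<^sub>R \<phi>) = r *\<^sub>R P \<phi>" for r \<phi>
      by (rule lipq_eqI) (simp add: P D_def m_scale LUCB)
    show "norm (P \<phi>) \<le> norm \<phi> * 1" for \<phi> using norm_P by simp
  qed
  moreover have "subspace ?S"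
    by (rule subspaceI) (simp_all add: S_iff del: mem_Collect_eq)
  moreover have "closed ?S"
  proof -
    \<comment> \<open>The range of a projection is its fixed-point set, which is closed because P is
      continuous.\<close>
    have "?S = {\<phi>. P \<phi> = \<phi>}" using P_S P_id by (metis (lifting) mem_Collect_eq)
    then show ?thesis
      using closed_Collect_eq[OF linear_continuous_on[OF \<open>bounded_linear P\<close>] continuous_on_id]
      by simp
  qed
  moreover have "P \<circ> P = P" using P_S P_id by (simp add: fun_eq_iff)
  moreover have "onorm P \<le> 1" using norm_P by (intro onorm_bound) simp_all
  moreover have "range P = ?S"
  proof
    show "range P \<subseteq> ?S" using P_S by blast
    show "?S \<subseteq> range P" using P_id by (metis rangeI subsetI)
  qed
  ultimately show ?thesis unfolding one_complemented_def by blast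
qed

end
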